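(* The system on $T^*\mathbb{R}^3\simeq\mathbb{R}^6$ $$\dot q_1=p_1,\quad \dot q_2=p_2,\quad \dot q_3=p_3-\tfrac12(q_1^2+q_2^2),$$ $$\dot p_1=q_1p_3-\tfrac12q_1^3-\tfrac12q_1q_2^2,\quad \dot p_2=q_2p_3-\tfrac12q_1^2q_2-\tfrac12q_2^3,\quad \dot p_3=0$$ takes the form $$\ddot q_1-q_1\dot q_3=0,\qquad \ddot q_2-q_2\dot q_3=0,\qquad \ddot q_3+q_1\dot q_1+q_2\dot q_2=0$$ on the tangent bundle $T\mathbb{R}^3$. Moreover, this second-order system represents the Euler-Lagrange equations generated by the Lagrangian $$L=\frac12\dot q_1^2+\frac12\dot q_2^2+\frac12\dot q_3^2+\frac12\dot q_3\left(q_1^2+q_2^2\right).$$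
   Context: Coordinates on $T^*\mathbb{R}^3$ are $(q_1,q_2,q_3,p_1,p_2,p_3)$ and on $T\mathbb{R}^3$ are $(q_1,q_2,q_3,\dot q_1,\dot q_2,\dot q_3)$; a dot denotes the derivative with respect to time $t$. The first-order system consists of Hamilton's equations for the Hamiltonian $\tilde H=\frac12p_1^2+\frac12p_2^2+\frac12\left[p_3-\frac12(q_1^2+q_2^2)\right]^2$. The Euler-Lagrange equations generated by $L$ are $\frac{d}{dt}\frac{\partial L}{\partial\dot q_i}-\frac{\partial L}{\partial q_i}=0$, $i=1,2,3$. *)

theory Defs
  imports "HOL-Analysis.Analysis"
begin

text \<open>
  Curves in \<open>\<real>\<^sup>3\<close> are total functions of time, looked at on an open interval \<open>I\<close> only; since \<open>I\<close> is open,
  derivatives at points of \<open>I\<close> do not depend on the values outside \<open>I\<close>.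
  Both \<open>T\<^sup>*\<real>\<^sup>3\<close> and \<open>T\<real>\<^sup>3\<close> are \<open>(real^3) \<times> (real^3)\<close>, the first component being the base point.
\<close>

definition velocity :: "(real \<Rightarrow> real^3) \<Rightarrow> real \<Rightarrow> real^3" where
  "velocity q t = vector_derivative q (at t)"

definition acceleration :: "(real \<Rightarrow> real^3) \<Rightarrow> real \<Rightarrow> real^3" where
  "acceleration q = velocity (velocity q)"

definition twice_differentiable :: "real set \<Rightarrow> (real \<Rightarrow> real^3) \<Rightarrow> bool" where
  "twice_differentiable I q \<longleftrightarrow>
     (\<forall>t\<in>I. q differentiable (at t) \<and> velocity q differentiable (at t))"

text \<open>
  Partial derivatives of a function of \<open>(x, y)\<close> with respect to \<open>x\<^sub>i\<close> and to \<open>y\<^sub>i\<close>. As \<open>deriv\<close> is total,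
  they are meaningful only where they exist, as they do everywhere for the polynomial functions below.
\<close>

definition partial_base :: "(real^3 \<Rightarrow> real^3 \<Rightarrow> real) \<Rightarrow> 3 \<Rightarrow> real^3 \<Rightarrow> real^3 \<Rightarrow> real" where
  "partial_base F i x y = deriv (\<lambda>s. F (x + s *\<^sub>R axis i 1) y) 0"

definition partial_fibre :: "(real^3 \<Rightarrow> real^3 \<Rightarrow> real) \<Rightarrow> 3 \<Rightarrow> real^3 \<Rightarrow> real^3 \<Rightarrow> real" where
  "partial_fibre F i x y = deriv (\<lambda>s. F x (y + s *\<^sub>R axis i 1)) 0"

definition first_order_solution ::
    "real set \<Rightarrow> (real \<Rightarrow> real^3) \<Rightarrow> (real \<Rightarrow> real^3) \<Rightarrow> bool" where
  "first_order_solution I q p \<longleftrightarrow> (\<forall>t\<in>I.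
     ((\<lambda>s. q s $ 1) has_real_derivative p t $ 1) (at t) \<and>
     ((\<lambda>s. q s $ 2) has_real_derivative p t $ 2) (at t) \<and>
     ((\<lambda>s. q s $ 3) has_real_derivative
        p t $ 3 - 1/2 * ((q t $ 1)^2 + (q t $ 2)^2)) (at t) \<and>
     ((\<lambda>s. p s $ 1) has_real_derivative
        q t $ 1 * p t $ 3 - 1/2 * (q t $ 1)^3 - 1/2 * q t $ 1 * (q t $ 2)^2) (at t) \<and>
     ((\<lambda>s. p s $ 2) has_real_derivative
        q t $ 2 * p t $ 3 - 1/2 * (q t $ 1)^2 * q t $ 2 - 1/2 * (q t $ 2)^3) (at t) \<and>
     ((\<lambda>s. p s $ 3) has_real_derivative 0) (at t))"

text \<open>
  The identification of \<open>T\<^sup>*\<real>\<^sup>3\<close> with \<open>T\<real>\<^sup>3\<close> under which the first-order system is rewritten: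
  the first three equations of that system, read as a map \<open>(q, p) \<mapsto> (q, v)\<close> over the identity of \<open>\<real>\<^sup>3\<close>.
\<close>

definition to_tangent :: "(real^3) \<times> (real^3) \<Rightarrow> (real^3) \<times> (real^3)" where
  "to_tangent = (\<lambda>(q, p).
     (q, vector [p $ 1, p $ 2, p $ 3 - 1/2 * ((q $ 1)^2 + (q $ 2)^2)]))"

definition second_order_lhs :: "(real \<Rightarrow> real^3) \<Rightarrow> real \<Rightarrow> real^3" where
  "second_order_lhs q t = vector
     [acceleration q t $ 1 - q t $ 1 * velocity q t $ 3,
      acceleration q t $ 2 - q t $ 2 * velocity q t $ 3,
      acceleration q t $ 3 + q t $ 1 * velocity q t $ 1 + q t $ 2 * velocity q t $ 2]"

definition second_order_solution :: "real set \<Rightarrow> (real \<Rightarrow> real^3) \<Rightarrow> bool" where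
  "second_order_solution I q \<longleftrightarrow>
     twice_differentiable I q \<and> (\<forall>t\<in>I. \<forall>i. second_order_lhs q t $ i = 0)"

definition euler_lagrange_lhs ::
    "(real^3 \<Rightarrow> real^3 \<Rightarrow> real) \<Rightarrow> (real \<Rightarrow> real^3) \<Rightarrow> 3 \<Rightarrow> real \<Rightarrow> real" where
  "euler_lagrange_lhs L q i t =
     deriv (\<lambda>s. partial_fibre L i (q s) (velocity q s)) t
     - partial_base L i (q t) (velocity q t)"

definition euler_lagrange_solution ::
    "(real^3 \<Rightarrow> real^3 \<Rightarrow> real) \<Rightarrow> real set \<Rightarrow> (real \<Rightarrow> real^3) \<Rightarrow> bool" where
  "euler_lagrange_solution L I q \<longleftrightarrow>
     twice_differentiable I q \<and>
     (\<forall>t\<in>I. \<forall>i. (\<lambda>s. partial_fibre L i (q s) (velocity q s)) differentiable (at t) \<and>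
        euler_lagrange_lhs L q i t = 0)"

definition lagrangian :: "real^3 \<Rightarrow> real^3 \<Rightarrow> real" where
  "lagrangian q v =
     1/2 * (v $ 1)^2 + 1/2 * (v $ 2)^2 + 1/2 * (v $ 3)^2
     + 1/2 * v $ 3 * ((q $ 1)^2 + (q $ 2)^2)"

definition hamiltonian :: "real^3 \<Rightarrow> real^3 \<Rightarrow> real" where
  "hamiltonian q p =
     1/2 * (p $ 1)^2 + 1/2 * (p $ 2)^2
     + 1/2 * (p $ 3 - 1/2 * ((q $ 1)^2 + (q $ 2)^2))^2"

lemma partial_fibre_hamiltonian:
  "partial_fibre hamiltonian 1 q p = p $ 1"
  "partial_fibre hamiltonian 2 q p = p $ 2"
  "partial_fibre hamiltonian 3 q p = p $ 3 - 1/2 * ((q $ 1)^2 + (q $ 2)^2)"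
  unfolding partial_fibre_def hamiltonian_def
  by (rule DERIV_imp_deriv; auto simp: axis_def field_simps intro!: derivative_eq_intros)+

lemma partial_base_hamiltonian:
  "partial_base hamiltonian 1 q p =
     - (q $ 1 * p $ 3 - 1/2 * (q $ 1)^3 - 1/2 * q $ 1 * (q $ 2)^2)"
  "partial_base hamiltonian 2 q p =
     - (q $ 2 * p $ 3 - 1/2 * (q $ 1)^2 * q $ 2 - 1/2 * (q $ 2)^3)"
  "partial_base hamiltonian 3 q p = 0"
  unfolding partial_base_def hamiltonian_def
  by (rule DERIV_imp_deriv;
      auto simp: axis_def field_simps power2_eq_square power3_eq_cube
           intro!: derivative_eq_intros)+

text \<open>The first-order system consists of Hamilton's equations for \<^const>\<open>hamiltonian\<close>.\<close>

lemma first_order_solution_iff_hamilton: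
  "first_order_solution I q p \<longleftrightarrow> (\<forall>t\<in>I. \<forall>i.
     ((\<lambda>s. q s $ i) has_real_derivative partial_fibre hamiltonian i (q t) (p t)) (at t) \<and>
     ((\<lambda>s. p s $ i) has_real_derivative - partial_base hamiltonian i (q t) (p t)) (at t))"
  unfolding first_order_solution_def forall_3 partial_fibre_hamiltonian partial_base_hamiltonian
  by (auto simp: algebra_simps)

end

theory Submission
  imports Defs
begin

text \<open>
  The first three equations of the Hamiltonian system say exactly that the fibre part of
  \<^const>\<open>to_tangent\<close> applied to \<open>(q, p)\<close> is the velocity of \<open>q\<close>. This part is \<open>p\<close> minus a vector that depends
  on \<open>q\<close> only, so \<^const>\<open>to_tangent\<close> is a fibrewise translation and hence bijective. Along a curve with
  \<open>v\<^sub>1 = p\<^sub>1\<close>, \<open>v\<^sub>2 = p\<^sub>2\<close> and \<open>v\<^sub>3 = p\<^sub>3 - 1/2 (q\<^sub>1\<^sup>2 + q\<^sub>2\<^sup>2)\<close>, differentiating these identities once turns the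
  remaining three equations into the second-order system, and conversely: the right-hand sides of the
  first two are \<open>q\<^sub>1 v\<^sub>3\<close> and \<open>q\<^sub>2 v\<^sub>3\<close>, and \<open>p\<^sub>3' = v\<^sub>3' + q\<^sub>1 v\<^sub>1 + q\<^sub>2 v\<^sub>2\<close> vanishes. The identities hold on the
  open set \<open>I\<close>, not just at one instant, which is what allows them to be differentiated
  (\<open>first_order_iff_second_order\<close>).

  The fibre derivatives of the Lagrangian are \<open>v\<^sub>1\<close>, \<open>v\<^sub>2\<close> and \<open>v\<^sub>3 + 1/2 (q\<^sub>1\<^sup>2 + q\<^sub>2\<^sup>2)\<close>, that is, the momenta
  again. Their time derivatives exist along every twice differentiable curve, and the Euler-Lagrange
  expressions are then the left-hand sides of the second-order system, term by term
  (\<open>euler_lagrange_lhs_lagrangian\<close>).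
\<close>

lemma has_vector_derivative_iff_components:
  fixes f :: "real \<Rightarrow> real^'n"
  shows "(f has_vector_derivative D) (at t) \<longleftrightarrow>
    (\<forall>i. ((\<lambda>s. f s $ i) has_real_derivative D $ i) (at t))"
  unfolding has_vector_derivative_def has_field_derivative_def
  by (subst has_derivative_componentwise_within)
     (auto simp: Basis_vec_def inner_axis mult_commute_abs)

lemma component_has_velocity:
  assumes "q differentiable (at t)"
  shows "((\<lambda>s. q s $ i) has_real_derivative velocity q t $ i) (at t)"
  using assms unfolding velocity_def
  by (simp add: vector_derivative_works has_vector_derivative_iff_components)

lemma velocity_from_components:
  assumes "\<And>i. ((\<lambda>s. q s $ i) has_real_derivative D $ i) (at t)"
  shows "q differentiable (at t)" and "velocity q t = D"
proof -
  have "(q has_vector_derivative D) (at t)"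
    using assms by (simp add: has_vector_derivative_iff_components)
  then show "q differentiable (at t)" and "velocity q t = D"
    by (auto simp: velocity_def vector_derivative_at differentiableI_vector)
qed

lemma twice_differentiable_components:
  assumes "twice_differentiable I q" and "t \<in> I"
  shows "((\<lambda>s. q s $ i) has_real_derivative velocity q t $ i) (at t)"
    and "((\<lambda>s. velocity q s $ i) has_real_derivative acceleration q t $ i) (at t)"
  using assms
  by (auto simp: twice_differentiable_def acceleration_def intro!: component_has_velocity)

lemma bij_to_tangent: "bij to_tangent"
proof (rule bij_betw_byWitness)
  let ?inv = "\<lambda>(q, v). (q, vector [v $ 1, v $ 2, v $ 3 + 1/2 * ((q $ 1)^2 + (q $ 2)^2)])
    :: (real^3) \<times> (real^3)"
  show "\<forall>x\<in>UNIV. ?inv (to_tangent x) = x" and "\<forall>x\<in>UNIV. to_tangent (?inv x) = x"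
    by (auto simp: to_tangent_def vec_eq_iff forall_3)
qed auto

lemma to_tangent_eq_velocity_iff:
  "to_tangent (x, p) = (x, v) \<longleftrightarrow>
     v $ 1 = p $ 1 \<and> v $ 2 = p $ 2 \<and> v $ 3 = p $ 3 - 1/2 * ((x $ 1)^2 + (x $ 2)^2)"
  by (auto simp: to_tangent_def vec_eq_iff forall_3)

lemma second_order_lhs_eq_0_iff:
  "(\<forall>i. second_order_lhs q t $ i = 0) \<longleftrightarrow>
     acceleration q t $ 1 = q t $ 1 * velocity q t $ 3 \<and>
     acceleration q t $ 2 = q t $ 2 * velocity q t $ 3 \<and>
     acceleration q t $ 3 = - (q t $ 1 * velocity q t $ 1 + q t $ 2 * velocity q t $ 2)"
  by (auto simp: second_order_lhs_def forall_3)

text \<open>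
  The term by which \<open>p\<^sub>3\<close> exceeds \<open>v\<^sub>3\<close>; its time derivative is what the third second-order equation
  adds to \<open>v\<^sub>3'\<close>, so that this equation expresses the conservation of \<open>p\<^sub>3\<close>.
\<close>

lemma half_square_sum_has_derivative:
  fixes q :: "real \<Rightarrow> real^3"
  assumes "((\<lambda>s. q s $ 1) has_real_derivative v1) (at t)"
    and "((\<lambda>s. q s $ 2) has_real_derivative v2) (at t)"
  shows "((\<lambda>s. 1/2 * ((q s $ 1)^2 + (q s $ 2)^2)) has_real_derivative
           q t $ 1 * v1 + q t $ 2 * v2) (at t)"
  using assms by (auto intro!: derivative_eq_intros)

text \<open>
  Since \<open>I\<close> is open, \<open>v\<close> agrees near each of its points with an expression in \<open>q\<close> and \<open>p\<close> that is
  differentiable there. This gives both the existence of the acceleration, which the first-order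
  system does not presuppose, and its value.
\<close>

lemma first_order_imp_second_order:
  assumes "open I" and sol: "first_order_solution I q p"
  shows "second_order_solution I q"
    and "\<forall>t\<in>I. to_tangent (q t, p t) = (q t, velocity q t)"
proof -
  have q: "((\<lambda>s. q s $ i) has_real_derivative snd (to_tangent (q t, p t)) $ i) (at t)"
    if "t \<in> I" for t i
    using sol that exhaust_3[of i] by (auto simp: first_order_solution_def to_tangent_def)
  show legendre: "\<forall>t\<in>I. to_tangent (q t, p t) = (q t, velocity q t)"
    using velocity_from_components(2)[OF q] by (simp add: to_tangent_def)
  have v: "velocity q t $ 1 = p t $ 1" "velocity q t $ 2 = p t $ 2"
    "velocity q t $ 3 = p t $ 3 - 1/2 * ((q t $ 1)^2 + (q t $ 2)^2)" if "t \<in> I" for t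
    using legendre that by (simp_all only: to_tangent_eq_velocity_iff)
  have main: "velocity q differentiable (at t) \<and> (\<forall>i. second_order_lhs q t $ i = 0)"
    if t: "t \<in> I" for t
  proof -
    \<comment> \<open>With \<open>p\<^sub>3 = v\<^sub>3 + 1/2 (q\<^sub>1\<^sup>2 + q\<^sub>2\<^sup>2)\<close> the cubic terms of the force cancel.\<close>
    have p: "((\<lambda>s. p s $ 1) has_real_derivative q t $ 1 * velocity q t $ 3) (at t)"
      "((\<lambda>s. p s $ 2) has_real_derivative q t $ 2 * velocity q t $ 3) (at t)"
      "((\<lambda>s. p s $ 3) has_real_derivative 0) (at t)"
      using sol t unfolding v(3)[OF t]
      by (auto simp: first_order_solution_def algebra_simps power2_eq_square power3_eq_cube)
    have q12: "((\<lambda>s. q s $ 1) has_real_derivative velocity q t $ 1) (at t)"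
      "((\<lambda>s. q s $ 2) has_real_derivative velocity q t $ 2) (at t)"
      using component_has_velocity velocity_from_components(1)[OF q[OF t]] by blast+
    let ?a = "vector [q t $ 1 * velocity q t $ 3, q t $ 2 * velocity q t $ 3,
      - (q t $ 1 * velocity q t $ 1 + q t $ 2 * velocity q t $ 2)] :: real^3"
    have "((\<lambda>s. velocity q s $ 1) has_real_derivative ?a $ 1) (at t)"
      using p(1) unfolding vector_3 by (rule has_field_derivative_transform_within_open[where S = I])
        (use \<open>open I\<close> t v in auto)
    moreover have "((\<lambda>s. velocity q s $ 2) has_real_derivative ?a $ 2) (at t)"
      using p(2) unfolding vector_3 by (rule has_field_derivative_transform_within_open[where S = I])
        (use \<open>open I\<close> t v in auto)
    moreover have "((\<lambda>s. velocity q s $ 3) has_real_derivative ?a $ 3) (at t)"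
      using DERIV_diff[OF p(3) half_square_sum_has_derivative[OF q12]]
      unfolding vector_3 diff_0
      by (rule has_field_derivative_transform_within_open[where S = I])
        (use \<open>open I\<close> t v in auto)
    ultimately have a: "((\<lambda>s. velocity q s $ i) has_real_derivative ?a $ i) (at t)" for i
      using exhaust_3[of i] by auto
    from velocity_from_components[OF a] show ?thesis
      by (simp add: second_order_lhs_eq_0_iff acceleration_def)
  qed
  show "second_order_solution I q"
    using main velocity_from_components(1)[OF q]
    by (simp add: second_order_solution_def twice_differentiable_def)
qed

text \<open>
  The same computation read backwards: on \<open>I\<close> the momentum is an expression in \<open>q\<close> and \<open>v\<close>, so
  its derivative follows from the acceleration.
\<close>

lemma second_order_imp_first_order:
  assumes "open I" and sol: "second_order_solution I q"
    and legendre: "\<forall>t\<in>I. to_tangent (q t, p t) = (q t, velocity q t)"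
  shows "first_order_solution I q p"
  unfolding first_order_solution_def
proof
  fix t assume t: "t \<in> I"
  have p: "p s $ 1 = velocity q s $ 1" "p s $ 2 = velocity q s $ 2"
    "p s $ 3 = velocity q s $ 3 + 1/2 * ((q s $ 1)^2 + (q s $ 2)^2)" if "s \<in> I" for s
    using legendre that by (simp_all add: to_tangent_eq_velocity_iff)
  have "twice_differentiable I q"
    using sol by (simp add: second_order_solution_def)
  note d = twice_differentiable_components[OF this t]
  have a: "acceleration q t $ 1 = q t $ 1 * velocity q t $ 3"
    "acceleration q t $ 2 = q t $ 2 * velocity q t $ 3"
    "acceleration q t $ 3 + (q t $ 1 * velocity q t $ 1 + q t $ 2 * velocity q t $ 2) = 0"
    using sol t by (simp_all add: second_order_solution_def second_order_lhs_eq_0_iff)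
  have "((\<lambda>s. p s $ 1) has_real_derivative q t $ 1 * velocity q t $ 3) (at t)"
    using d(2)[of 1] unfolding a by (rule has_field_derivative_transform_within_open[where S = I])
        (use \<open>open I\<close> t p in auto)
  moreover have "((\<lambda>s. p s $ 2) has_real_derivative q t $ 2 * velocity q t $ 3) (at t)"
    using d(2)[of 2] unfolding a by (rule has_field_derivative_transform_within_open[where S = I])
        (use \<open>open I\<close> t p in auto)
  moreover have "((\<lambda>s. p s $ 3) has_real_derivative 0) (at t)"
    using DERIV_add[OF d(2)[of 3] half_square_sum_has_derivative[OF d(1)[of 1] d(1)[of 2]]]
    unfolding a by (rule has_field_derivative_transform_within_open[where S = I])
        (use \<open>open I\<close> t p in auto)
  ultimately show
    "((\<lambda>s. q s $ 1) has_real_derivative p t $ 1) (at t) \<and>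
     ((\<lambda>s. q s $ 2) has_real_derivative p t $ 2) (at t) \<and>
     ((\<lambda>s. q s $ 3) has_real_derivative
        p t $ 3 - 1/2 * ((q t $ 1)^2 + (q t $ 2)^2)) (at t) \<and>
     ((\<lambda>s. p s $ 1) has_real_derivative
        q t $ 1 * p t $ 3 - 1/2 * (q t $ 1)^3 - 1/2 * q t $ 1 * (q t $ 2)^2) (at t) \<and>
     ((\<lambda>s. p s $ 2) has_real_derivative
        q t $ 2 * p t $ 3 - 1/2 * (q t $ 1)^2 * q t $ 2 - 1/2 * (q t $ 2)^3) (at t) \<and>
     ((\<lambda>s. p s $ 3) has_real_derivative 0) (at t)"
    using d(1)[of 1] d(1)[of 2] d(1)[of 3] p[OF t]
    by (simp add: algebra_simps power2_eq_square power3_eq_cube)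
qed

lemma first_order_iff_second_order:
  assumes "open I"
  shows "first_order_solution I q p \<longleftrightarrow>
    second_order_solution I q \<and> (\<forall>t\<in>I. to_tangent (q t, p t) = (q t, velocity q t))"
  using first_order_imp_second_order[OF assms] second_order_imp_first_order[OF assms] by blast

lemma partial_fibre_lagrangian:
  "partial_fibre lagrangian 1 x v = v $ 1"
  "partial_fibre lagrangian 2 x v = v $ 2"
  "partial_fibre lagrangian 3 x v = v $ 3 + 1/2 * ((x $ 1)^2 + (x $ 2)^2)"
  unfolding partial_fibre_def lagrangian_def
  by (rule DERIV_imp_deriv; auto simp: axis_def field_simps intro!: derivative_eq_intros)+

lemma partial_base_lagrangian:
  "partial_base lagrangian 1 x v = x $ 1 * v $ 3"
  "partial_base lagrangian 2 x v = x $ 2 * v $ 3"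
  "partial_base lagrangian 3 x v = 0"
  unfolding partial_base_def lagrangian_def
  by (rule DERIV_imp_deriv; auto simp: axis_def field_simps intro!: derivative_eq_intros)+

text \<open>
  Existence of the derivative is part of the claim: because \<^const>\<open>deriv\<close> is total, the value of
  \<^const>\<open>euler_lagrange_lhs\<close> alone would not supply the differentiability that
  \<^const>\<open>euler_lagrange_solution\<close> requires.
\<close>

lemma momentum_has_derivative:
  assumes "twice_differentiable I q" and "t \<in> I"
  shows "((\<lambda>s. partial_fibre lagrangian i (q s) (velocity q s)) has_real_derivative
           second_order_lhs q t $ i + partial_base lagrangian i (q t) (velocity q t)) (at t)"
proof -
  note d = twice_differentiable_components[OF assms]
  have "((\<lambda>s. velocity q s $ 3 + 1/2 * ((q s $ 1)^2 + (q s $ 2)^2)) has_real_derivative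
      acceleration q t $ 3 + (q t $ 1 * velocity q t $ 1 + q t $ 2 * velocity q t $ 2)) (at t)"
    by (intro DERIV_add half_square_sum_has_derivative d)
  then show ?thesis
    using exhaust_3[of i] d(2)[of 1] d(2)[of 2]
    by (auto simp: partial_fibre_lagrangian partial_base_lagrangian second_order_lhs_def add.assoc)
qed

lemma euler_lagrange_lhs_lagrangian:
  assumes "twice_differentiable I q" and "t \<in> I"
  shows "euler_lagrange_lhs lagrangian q i t = second_order_lhs q t $ i"
  using DERIV_imp_deriv[OF momentum_has_derivative[OF assms]]
  by (simp add: euler_lagrange_lhs_def)

lemma euler_lagrange_iff_second_order:
  "euler_lagrange_solution lagrangian I q \<longleftrightarrow> second_order_solution I q"
proof -
  have "(\<lambda>s. partial_fibre lagrangian i (q s) (velocity q s)) differentiable (at t)"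
    if "twice_differentiable I q" and "t \<in> I" for t i
    using momentum_has_derivative[OF that] real_differentiable_def by blast
  then show ?thesis
    by (auto simp: euler_lagrange_solution_def second_order_solution_def
        euler_lagrange_lhs_lagrangian)
qed

theorem theorem2p2:
  fixes I :: "real set"
  assumes "open I" and "is_interval I"
  shows
    "bij to_tangent \<and>
     (\<forall>q p. first_order_solution I q p \<longleftrightarrow>
        second_order_solution I q \<and>
        (\<forall>t\<in>I. to_tangent (q t, p t) = (q t, velocity q t))) \<and>
     (\<forall>q. twice_differentiable I q \<longrightarrow>
        (\<forall>t\<in>I. \<forall>i. euler_lagrange_lhs lagrangian q i t = second_order_lhs q t $ i)) \<and>
     (\<forall>q. euler_lagrange_solution lagrangian I q \<longleftrightarrow> second_order_solution I q)"
  using bij_to_tangent first_order_iff_second_order[OF \<open>open I\<close>] euler_lagrange_lhs_lagrangian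
    euler_lagrange_iff_second_order
  by blast

end
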